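(* Let $M^{-1}A$ be $B$-normal and let $V_r=[v_1^{(r)}\ \cdots\ v_n^{(r)}]$ and $V_l=[v_1^{(l)}\ \cdots\ v_n^{(l)}]$ be the right and left eigenvectors, respectively, of the generalized eigenvalue problem $Az=\lambda Mz$, such that $$AV_r=MV_r\Lambda\qquad\text{and}\qquad V_l^HA=\Lambda V_l^HM$$ are satisfied with the diagonal eigenvalue matrix $\Lambda=\mathrm{diag}(\lambda_1,\dots,\lambda_n)=\begin{bmatrix}\Lambda_{n_c}&0\\0&\Lambda_{n_f}\end{bmatrix}$, where $\Lambda_{n_c}\in\mathbb{C}^{n_c\times n_c}$ and $\Lambda_{n_f}\in\mathbb{C}^{n_f\times n_f}$. Assume that the eigenvalues are ordered such that $$|1-\lambda_1|\ge|1-\lambda_2|\ge\dots\ge|1-\lambda_n|$$ and equal eigenvalues form a single diagonal block in $\Lambda$. Let $B=V_r^{-H}D^{-1}V_r^{-1}$, where $$D=\begin{bmatrix}D_{n_c}&0\\0&D_{n_f}\end{bmatrix}\in\mathbb{C}^{n\times n}$$ is HPD block diagonal with $D_{n_c}\in\mathbb{C}^{n_c\times n_c}$ and $D_{n_f}\in\mathbb{C}^{n_f\times n_f}$, and both $D_{n_c}$ and $D_{n_f}$ are also HPD block diagonal with block sizes corresponding to those in $\Lambda_{n_c}$ and $\Lambda_{n_f}$. Furthermore, let $P_\#,R_\#\in\mathbb{C}^{n\times n_c}$ be defined such that $$\mathcal R(P_\#)=\mathcal R([v_1^{(r)}\ \cdots\ v_{n_c}^{(r)}])\quad\text{and}\quad\mathcal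 R(R_\#)=\mathcal R([v_1^{(l)}\ \cdots\ v_{n_c}^{(l)}]).$$ Then $\Pi_A(P_\#,R_\#)$ is $B$-orthogonal and it holds $$\rho(E^{\nu_1,\nu_2}(P_\#,R_\#))=\lVert E^{\nu_1,\nu_2}(P_\#,R_\#)\rVert_B=|1-\lambda_{n_c+1}|^{\nu_1+\nu_2}.$$
   Context: $A,M\in\mathbb{C}^{n\times n}$ are nonsingular, where $A$ is in general nonsymmetric and indefinite, and $n_c,n_f<n$ with $n_c+n_f=n$. HPD means Hermitian positive definite; $V^{-H}=(V^H)^{-1}$; $\mathcal R(\cdot)$ denotes the range and $\rho$ the spectral radius. The eigenvector matrices $V_r,V_l\in\mathbb{C}^{n\times n}$ are nonsingular. The blocks of $\Lambda$ to which block sizes refer are those formed by equal eigenvalues. For HPD $B\in\mathbb{C}^{n\times n}$, $\lVert x\rVert_B=\sqrt{x^HBx}$ on vectors, and $\lVert C\rVert_B=\sup_{x\ne0}\lVert Cx\rVert_B/\lVert x\rVert_B$ on matrices. The $B$-adjoint of $C\in\mathbb{C}^{n\times n}$ is $C^+=B^{-1}C^HB$; $C$ is $B$-normal if $CC^+=C^+C$ and $B$-orthogonal if $C^+=C$. For $P,R\in\mathbb{C}^{n\times n_c}$ the coarse-grid matrix $R^HAP$ is always assumed to be nonsingular (in particular for $P=P_\#$, $R=R_\#$), and $\Pi_A(P,R)=P(R^HAP)^{-1}R^HA$. For $\nu_1,\nu_2\in\mathbb{N}_0$ (numbers of pre- and post-smoothing steps), $E^{\nu_1,\nu_2}(P,R)=(I-M^{-1}A)^{\nu_2}(I-\Pi_A(P,R))(I-M^{-1}A)^{\nu_1}$,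 where a zeroth power is $I$ (respectively $1$ for scalars). *)

theory Defs
  imports
    "Jordan_Normal_Form.Schur_Decomposition"
    "Jordan_Normal_Form.Spectral_Radius"
    "Jordan_Normal_Form.VS_Connect"
begin

section \<open>Matrix preliminaries\<close>

text \<open>Only meaningful for nonsingular matrices.\<close>

definition minv :: "complex mat \<Rightarrow> complex mat" where
  "minv A = the (mat_inverse A)"

definition hermitian_pd :: "nat \<Rightarrow> complex mat \<Rightarrow> bool" where
  "hermitian_pd n B \<longleftrightarrow> B \<in> carrier_mat n n \<and> mat_adjoint B = B \<and>
     (\<forall>x \<in> carrier_vec n. x \<noteq> 0\<^sub>v n \<longrightarrow> 0 < Re ((B *\<^sub>v x) \<bullet>c x))"

definition first_cols :: "nat \<Rightarrow> complex mat \<Rightarrow> complex mat" where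
  "first_cols k V = mat_of_cols (dim_row V) (take k (cols V))"

abbreviation col_range :: "complex mat \<Rightarrow> complex vec set" where
  "col_range X \<equiv> vec_space.col_space (dim_row X) X"


section \<open>Block structure\<close>

text \<open>
  A list of pairs \<open>(k, \<mu>)\<close> describes consecutive diagonal blocks: a block of size \<open>k\<close> whose
  eigenvalue is \<open>\<mu>\<close>.
\<close>

definition scalar_blocks :: "(nat \<times> complex) list \<Rightarrow> complex mat" where
  "scalar_blocks bs = diag_block_mat (map (\<lambda>(k, \<mu>). \<mu> \<cdot>\<^sub>m 1\<^sub>m k) bs)"

text \<open>
  The blocks of \<open>L1 = scalar_blocks bs1\<close> and \<open>L2 = scalar_blocks bs2\<close> are those formed by equal
  eigenvalues of \<open>diag(L1, L2)\<close>, each eigenvalue forming one single block. Every such block lies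
  in \<open>L1\<close> or in \<open>L2\<close>; in particular \<open>L1\<close> and \<open>L2\<close> have no eigenvalue in common.
  (Were an eigenvalue shared, the leading right and left eigenvectors could be chosen
  independently within its eigenspaces, and the coarse projection need not be \<open>B\<close>-self-adjoint.)
\<close>

definition equal_eigenvalue_blocks ::
  "complex mat \<Rightarrow> complex mat \<Rightarrow> (nat \<times> complex) list \<Rightarrow> (nat \<times> complex) list \<Rightarrow> bool" where
  "equal_eigenvalue_blocks L1 L2 bs1 bs2 \<longleftrightarrow>
     L1 = scalar_blocks bs1 \<and> L2 = scalar_blocks bs2 \<and>
     (\<forall>(k, \<mu>) \<in> set (bs1 @ bs2). 0 < k) \<and> distinct (map snd (bs1 @ bs2))"

definition block_diagonal :: "nat list \<Rightarrow> complex mat \<Rightarrow> bool" where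
  "block_diagonal ks X \<longleftrightarrow>
     (\<exists>Xs. X = diag_block_mat Xs \<and> list_all2 (\<lambda>k Y. Y \<in> carrier_mat k k) ks Xs)"

definition block_diag2 :: "complex mat \<Rightarrow> complex mat \<Rightarrow> complex mat" where
  "block_diag2 X Y = diag_block_mat [X, Y]"


section \<open>The geometry induced by an HPD matrix \<open>B\<close>\<close>

definition vnormB :: "complex mat \<Rightarrow> complex vec \<Rightarrow> real" where
  "vnormB B x = sqrt (Re ((B *\<^sub>v x) \<bullet>c x))"

definition mnormB :: "complex mat \<Rightarrow> complex mat \<Rightarrow> real" where
  "mnormB B C =
     (SUP x \<in> {x \<in> carrier_vec (dim_col C). x \<noteq> 0\<^sub>v (dim_col C)}. vnormB B (C *\<^sub>v x) / vnormB B x)"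

definition adjointB :: "complex mat \<Rightarrow> complex mat \<Rightarrow> complex mat" where
  "adjointB B C = minv B * mat_adjoint C * B"

definition normalB :: "complex mat \<Rightarrow> complex mat \<Rightarrow> bool" where
  "normalB B C \<longleftrightarrow> C * adjointB B C = adjointB B C * C"

text \<open>Self-adjointness in the \<open>B\<close>-inner product, as is customary for projections.\<close>

definition orthogonalB :: "complex mat \<Rightarrow> complex mat \<Rightarrow> bool" where
  "orthogonalB B C \<longleftrightarrow> adjointB B C = C"


section \<open>Two-grid operators\<close>

definition coarse_mat :: "complex mat \<Rightarrow> complex mat \<Rightarrow> complex mat \<Rightarrow> complex mat" where
  "coarse_mat A P R = mat_adjoint R * A * P"

definition coarse_proj :: "complex mat \<Rightarrow> complex mat \<Rightarrow> complex mat \<Rightarrow> complex mat" where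
  "coarse_proj A P R = P * minv (coarse_mat A P R) * mat_adjoint R * A"

definition two_grid ::
  "complex mat \<Rightarrow> complex mat \<Rightarrow> nat \<Rightarrow> nat \<Rightarrow> complex mat \<Rightarrow> complex mat \<Rightarrow> complex mat" where
  "two_grid A M \<nu>1 \<nu>2 P R =
     (let n = dim_row A; S = 1\<^sub>m n - minv M * A
      in S ^\<^sub>m \<nu>2 * (1\<^sub>m n - coarse_proj A P R) * S ^\<^sub>m \<nu>1)"

end

theory Submission
  imports Defs
begin

text \<open>
  Everything is diagonal in the right eigenbasis: \<open>M\<^sup>-\<^sup>1 A = V\<^sub>r \<Lambda> V\<^sub>r\<^sup>-\<^sup>1\<close>, and since
  \<open>V\<^sub>l\<^sup>H M V\<^sub>r\<close> commutes with \<open>\<Lambda>\<close> it has no entries coupling the first \<open>n\<^sub>c\<close> eigenvectors to the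
  others, which makes the coarse projection equal to \<open>V\<^sub>r K V\<^sub>r\<^sup>-\<^sup>1\<close> with \<open>K = diag(I, 0)\<close>. Hence
  the two-grid operator is \<open>V\<^sub>r T V\<^sub>r\<^sup>-\<^sup>1\<close> for a diagonal \<open>T\<close> whose largest entry is
  \<open>(1 - \<lambda>\<^sub>n\<^sub>c\<^sub>+\<^sub>1)\<close> to the power \<open>\<nu>\<^sub>1 + \<nu>\<^sub>2\<close>. In eigenvector coordinates the \<open>B\<close>-inner product has
  Gram matrix \<open>D\<^sup>-\<^sup>1\<close>, which commutes with \<open>\<Lambda>\<close> and therefore with every diagonal matrix that is
  constant on equal eigenvalues, in particular with \<open>K\<close> and \<open>T\<close>.
\<close>

section \<open>Inverses and adjoints\<close>

text \<open>Associativity with its side conditions phrased as equations between dimensions, which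
  the simplifier can discharge itself; as a rewrite rule it nests every product to the
  right.\<close>

lemma assoc_mult_mat_dim:
  "dim_col X = dim_row Y \<Longrightarrow> dim_col Y = dim_row Z \<Longrightarrow> X * Y * Z = X * (Y * (Z :: 'a :: semiring_0 mat))"
  by (rule assoc_mult_mat[of _ "dim_row X" "dim_col X" _ "dim_col Y" _ "dim_col Z"]) auto

lemma mult_mat_cancel_left:
  assumes "X * Y = 1\<^sub>m n" "dim_col X = dim_row Y" "dim_col Y = dim_row Z" "dim_row Z = n"
  shows "X * (Y * Z) = (Z :: 'a :: semiring_1 mat)"
  using assms by (simp flip: assoc_mult_mat_dim)

text \<open>An invertible matrix is a unit of the matrix ring, so \<open>mat_inverse\<close> returns
  \<open>Some\<close> and \<open>the\<close> in \<open>minv\<close> yields a genuine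
  inverse.\<close>

lemma minv_inverse:
  assumes "A \<in> carrier_mat n n" "invertible_mat A"
  shows "minv A \<in> carrier_mat n n" "A * minv A = 1\<^sub>m n" "minv A * A = 1\<^sub>m n"
proof -
  obtain C where C: "A * C = 1\<^sub>m n" "C * A = 1\<^sub>m (dim_row C)"
    using assms unfolding invertible_mat_def inverts_mat_def by auto
  \<comment> \<open>The predicate \<open>invertible_mat\<close> leaves the shape of \<open>C\<close>
    open; it is recovered by counting columns on both sides of the two identities.\<close>
  have dims: "C \<in> carrier_mat n n"
  proof
    show "dim_col C = n" using arg_cong[OF C(1), of dim_col] by simp
    show "dim_row C = n" using arg_cong[OF C(2), of dim_col] assms(1) by simp
  qed
  hence "A \<in> Units (ring_mat TYPE(complex) n ())"
    using C assms(1) by (auto simp: Units_def ring_mat_def)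
  then obtain G where "mat_inverse A = Some G"
    using mat_inverse(1)[OF assms(1)] by fastforce
  thus "minv A \<in> carrier_mat n n" "A * minv A = 1\<^sub>m n" "minv A * A = 1\<^sub>m n"
    using mat_inverse(2)[OF assms(1)] unfolding minv_def by auto
qed

lemma invertible_matI:
  assumes "A \<in> carrier_mat n n" "C \<in> carrier_mat n n" "A * C = 1\<^sub>m n"
  shows "invertible_mat (A :: complex mat)"
  using assms mat_mult_left_right_inverse[OF assms]
  unfolding invertible_mat_def inverts_mat_def by auto

lemma minv_unique:
  assumes "A \<in> carrier_mat n n" "C \<in> carrier_mat n n" "A * C = 1\<^sub>m n"
  shows "minv A = C"
proof -
  note m = minv_inverse[OF assms(1) invertible_matI[OF assms]]
  have "minv A = minv A * (A * C)" using m assms by simp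
  also have "\<dots> = C" by (rule mult_mat_cancel_left[OF m(3)]) (use m assms in auto)
  finally show ?thesis .
qed

lemma mat_adjoint_index [simp]:
  "dim_row (mat_adjoint A) = dim_col A" "dim_col (mat_adjoint A) = dim_row A"
  "i < dim_col A \<Longrightarrow> j < dim_row A \<Longrightarrow> mat_adjoint A $$ (i, j) = conjugate (A $$ (j, i))"
  unfolding mat_adjoint_def by (simp_all add: mat_of_rows_index)

lemma mat_adjoint_carrier [simp]:
  "A \<in> carrier_mat n m \<Longrightarrow> mat_adjoint A \<in> carrier_mat m n"
  by (rule carrier_matI) simp_all

lemma mat_adjoint_adjoint [simp]: "mat_adjoint (mat_adjoint A) = (A :: complex mat)"
  by (rule eq_matI) auto

lemma mat_adjoint_mult:
  "dim_col A = dim_row C \<Longrightarrow> mat_adjoint (A * C) = mat_adjoint C * mat_adjoint (A :: complex mat)"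
  by (rule eq_matI) (simp_all add: scalar_prod_def mult.commute)

lemma mat_adjoint_one [simp]: "mat_adjoint (1\<^sub>m n) = (1\<^sub>m n :: complex mat)"
  by (rule eq_matI) auto

lemma mat_adjoint_mat_diag [simp]:
  "mat_adjoint (mat_diag n f) = mat_diag n (\<lambda>i. cnj (f i))"
  by (rule eq_matI) (auto simp: mat_diag_def)

lemma scalar_prod_mat_adjoint:
  assumes "A \<in> carrier_mat n m" "x \<in> carrier_vec m" "y \<in> carrier_vec n"
  shows "(A *\<^sub>v x) \<bullet>c y = x \<bullet>c (mat_adjoint A *\<^sub>v (y :: complex vec))"
proof -
  have "(A *\<^sub>v x) \<bullet>c y = (\<Sum>i<n. \<Sum>j<m. A $$ (i, j) * x $ j * cnj (y $ i))"
    using assms by (simp add: scalar_prod_def sum_distrib_right atLeast0LessThan)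
  also have "\<dots> = (\<Sum>j<m. \<Sum>i<n. A $$ (i, j) * x $ j * cnj (y $ i))"
    by (rule sum.swap)
  also have "\<dots> = (\<Sum>j<m. \<Sum>i<n. x $ j * (A $$ (i, j) * cnj (y $ i)))"
    by (simp only: mult_ac)
  also have "\<dots> = x \<bullet>c (mat_adjoint A *\<^sub>v y)"
    using assms by (simp add: scalar_prod_def sum_distrib_left atLeast0LessThan)
  finally show ?thesis .
qed

section \<open>Commuting with a diagonal matrix\<close>

lemma dim_mat_diag [simp]: "dim_row (mat_diag n f) = n" "dim_col (mat_diag n f) = n"
  by (simp_all add: mat_diag_def)

text \<open>Comparing entries, commutation says that \<open>C $$ (i, j)\<close> is multiplied by the
  same number whether scaled by column or by row.\<close>

lemma commutes_mat_diag_iff: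
  assumes "C \<in> carrier_mat n n"
  shows "C * mat_diag n f = mat_diag n f * C \<longleftrightarrow>
    (\<forall>i<n. \<forall>j<n. C $$ (i, j) = 0 \<or> f i = (f j :: complex))"
proof -
  have *: "x * f j = f i * x \<longleftrightarrow> x = 0 \<or> f i = f j" for x i j
    by (auto simp: mult.commute)
  have "C * mat_diag n f = mat_diag n f * C \<longleftrightarrow>
      (\<forall>i<n. \<forall>j<n. C $$ (i, j) * f j = f i * C $$ (i, j))"
    using assms by (auto simp: mat_diag_mult_left mat_diag_mult_right mat_eq_iff)
  thus ?thesis unfolding * .
qed

text \<open>A nonzero entry of \<open>C\<close> can only join indices with equal \<open>l\<close>,
  and there \<open>f\<close> agrees as well. This carries commutation with the eigenvalue matrix
  over to any function of the eigenvalues.\<close>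

lemma commutes_mat_diag_fun:
  assumes "C \<in> carrier_mat n n" "C * mat_diag n l = mat_diag n l * C"
    and "\<And>i j. i < n \<Longrightarrow> j < n \<Longrightarrow> l i = l j \<Longrightarrow> f i = (f j :: complex)"
  shows "C * mat_diag n f = mat_diag n f * C"
  using assms(2,3) unfolding commutes_mat_diag_iff[OF assms(1)] by blast

lemma inverse_commutes:
  assumes "C \<in> carrier_mat n n" "F \<in> carrier_mat n n" "C * F = 1\<^sub>m n" "F * C = 1\<^sub>m n"
    and "X \<in> carrier_mat n n" "C * X = X * (C :: complex mat)"
  shows "F * X = X * F"
proof -
  have [simp]: "dim_row C = n" "dim_col C = n" "dim_row F = n" "dim_col F = n"
    "dim_row X = n" "dim_col X = n" using assms by auto
  have "F * X = F * (X * C) * F"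
    using assms(2,3,5) by (simp add: assoc_mult_mat_dim)
  also have "\<dots> = F * (C * X) * F" using assms by simp
  also have "\<dots> = X * F"
    by (simp add: assoc_mult_mat_dim mult_mat_cancel_left[OF assms(4)])
  finally show ?thesis .
qed

lemma diag_block_mat_carrier:
  "list_all2 (\<lambda>(k, \<mu> :: complex) Y. Y \<in> carrier_mat k k) bs Ys \<Longrightarrow>
    diag_block_mat Ys \<in> carrier_mat (sum_list (map fst bs)) (sum_list (map fst bs))"
  by (induction rule: list_all2_induct) (auto simp: Let_def split: prod.splits)

lemma scalar_blocks_carrier:
  "scalar_blocks bs \<in> carrier_mat (sum_list (map fst bs)) (sum_list (map fst bs))"
  by (induction bs) (auto simp: scalar_blocks_def Let_def)

text \<open>Each block meets only a scalar multiple of the identity of its own size, with which it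
  commutes; the induction peels off the first block.\<close>

lemma diag_block_mat_commutes_scalar_blocks:
  assumes "list_all2 (\<lambda>(k, \<mu>) Y. Y \<in> carrier_mat k k) bs Ys"
  shows "diag_block_mat Ys * scalar_blocks bs = scalar_blocks bs * diag_block_mat Ys"
  using assms
proof (induction rule: list_all2_induct)
  case Nil
  show ?case by (simp add: scalar_blocks_def)
next
  case (Cons b bs Y Ys)
  obtain k \<mu> where b: "b = (k, \<mu>)" by fastforce
  define m where "m = sum_list (map fst bs)"
  have Y: "Y \<in> carrier_mat k k" using Cons b by auto
  have c: "diag_block_mat Ys \<in> carrier_mat m m" "scalar_blocks bs \<in> carrier_mat m m"
    using diag_block_mat_carrier[OF Cons(2)] scalar_blocks_carrier unfolding m_def by auto
  have e: "scalar_blocks (b # bs) =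
      four_block_mat (\<mu> \<cdot>\<^sub>m 1\<^sub>m k) (0\<^sub>m k m) (0\<^sub>m m k) (scalar_blocks bs)"
    using c(2) unfolding scalar_blocks_def b by (simp add: Let_def)
  have d: "diag_block_mat (Y # Ys) = four_block_mat Y (0\<^sub>m k m) (0\<^sub>m m k) (diag_block_mat Ys)"
    using c(1) Y by (simp add: Let_def)
  have s: "\<mu> \<cdot>\<^sub>m 1\<^sub>m k \<in> carrier_mat k k" by simp
  have z: "0\<^sub>m k m \<in> carrier_mat k m" "0\<^sub>m m k \<in> carrier_mat m k" by auto
  have \<mu>: "Y * (\<mu> \<cdot>\<^sub>m 1\<^sub>m k) = \<mu> \<cdot>\<^sub>m Y" "\<mu> \<cdot>\<^sub>m 1\<^sub>m k * Y = \<mu> \<cdot>\<^sub>m Y"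
    using Y by (simp_all add: mult_smult_distrib[OF Y one_carrier_mat] mult_smult_assoc_mat[OF one_carrier_mat Y])
  show ?case unfolding d e
    unfolding mult_four_block_mat[OF Y z c(1) s z c(2)] mult_four_block_mat[OF s z c(2) Y z c(1)]
    using Cons.IH Y c by (simp add: \<mu>)
qed

text \<open>Together with distinctness of the listed eigenvalues, this will separate the leading
  eigenvalues from the trailing ones.\<close>

lemma scalar_blocks_diag_entry:
  "i < dim_row (scalar_blocks bs) \<Longrightarrow> scalar_blocks bs $$ (i, i) \<in> snd ` set bs"
proof (induction bs arbitrary: i)
  case Nil
  thus ?case by (simp add: scalar_blocks_def)
next
  case (Cons b bs)
  obtain k \<mu> where b: "b = (k, \<mu>)" by fastforce
  define m where "m = sum_list (map fst bs)"
  have c: "scalar_blocks bs \<in> carrier_mat m m"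
    using scalar_blocks_carrier unfolding m_def by auto
  have e: "scalar_blocks (b # bs) =
      four_block_mat (\<mu> \<cdot>\<^sub>m 1\<^sub>m k) (0\<^sub>m k m) (0\<^sub>m m k) (scalar_blocks bs)"
    using c unfolding scalar_blocks_def b by (simp add: Let_def)
  show ?case
  proof (cases "i < k")
    case True
    hence "scalar_blocks (b # bs) $$ (i, i) = \<mu>"
      unfolding e by (subst index_mat_four_block(1)) (use True in auto)
    thus ?thesis by (simp add: b)
  next
    case False
    have i: "i < k + m" using Cons.prems c unfolding e by simp
    have "scalar_blocks (b # bs) $$ (i, i) = scalar_blocks bs $$ (i - k, i - k)"
      unfolding e by (subst index_mat_four_block(1)) (use i c False in simp_all)
    thus ?thesis using Cons.IH[of "i - k"] i c False by simp
  qed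
qed

lemma block_diag2_four_block:
  "block_diag2 X Y =
    four_block_mat X (0\<^sub>m (dim_row X) (dim_col Y)) (0\<^sub>m (dim_row Y) (dim_col X)) Y"
  unfolding block_diag2_def diag_block_mat.simps(2)[of X] diag_block_mat_singleton Let_def ..

lemma block_diag2_diag_block_mat:
  "block_diag2 (diag_block_mat Xs) (diag_block_mat Ys) = diag_block_mat (Xs @ Ys)"
  unfolding block_diag2_four_block diag_block_mat_append Let_def ..

section \<open>Hermitian forms and the induced norm\<close>

lemma hermitian_pd_invertible:
  assumes "hermitian_pd n D"
  shows "invertible_mat D"
proof -
  have D: "D \<in> carrier_mat n n" using assms unfolding hermitian_pd_def by blast
  have "det D \<noteq> 0"
  proof
    assume "det D = 0"
    then obtain v where v: "v \<in> carrier_vec n" "v \<noteq> 0\<^sub>v n" "D *\<^sub>v v = 0\<^sub>v n"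
      using det_0_iff_vec_prod_zero[OF D] by auto
    hence "0 < Re ((D *\<^sub>v v) \<bullet>c v)" using assms unfolding hermitian_pd_def by blast
    thus False using v by simp
  qed
  then obtain C where "inverts_mat D C" "C \<in> carrier_mat n n"
    using D det_non_zero_imp_unit[OF D, of "()"]
    by (auto simp: Units_def ring_mat_def inverts_mat_def)
  thus ?thesis using invertible_matI[OF D] D unfolding inverts_mat_def by auto
qed

text \<open>Substituting \<open>u = D z\<close> turns \<open>u\<^sup>H D\<^sup>-\<^sup>1 u\<close> into \<open>z\<^sup>H D z\<close>.\<close>

lemma hermitian_pd_minv_pos:
  assumes "hermitian_pd n D" "u \<in> carrier_vec n" "u \<noteq> 0\<^sub>v n"
  shows "0 < Re ((minv D *\<^sub>v u) \<bullet>c u)"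
proof -
  have D: "D \<in> carrier_mat n n" "mat_adjoint D = D"
    and pos: "\<And>x. x \<in> carrier_vec n \<Longrightarrow> x \<noteq> 0\<^sub>v n \<Longrightarrow> 0 < Re ((D *\<^sub>v x) \<bullet>c x)"
    using assms(1) unfolding hermitian_pd_def by auto
  note m = minv_inverse[OF D(1) hermitian_pd_invertible[OF assms(1)]]
  define z where "z = minv D *\<^sub>v u"
  have z: "z \<in> carrier_vec n" using m assms(2) unfolding z_def by auto
  have "D *\<^sub>v z = (D * minv D) *\<^sub>v u" using m(1) D assms(2) unfolding z_def by simp
  hence u: "D *\<^sub>v z = u" using m(2) assms(2) by simp
  have "z \<noteq> 0\<^sub>v n" using u assms(3) D by auto
  hence "0 < Re ((D *\<^sub>v z) \<bullet>c z)" using pos z by blast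
  also have "(D *\<^sub>v z) \<bullet>c z = z \<bullet>c u" using scalar_prod_mat_adjoint[OF D(1) z z] D(2) u by simp
  finally show ?thesis unfolding z_def .
qed

lemma vnormB_smult:
  assumes "B \<in> carrier_mat n n" "x \<in> carrier_vec n"
  shows "vnormB B (t \<cdot>\<^sub>v x) = cmod t * vnormB B x"
proof -
  have "(B *\<^sub>v (t \<cdot>\<^sub>v x)) \<bullet>c (t \<cdot>\<^sub>v x) = (t * cnj t) * ((B *\<^sub>v x) \<bullet>c x)"
    using assms by (simp add: mult_mat_vec conjugate_smult_vec)
  also have "t * cnj t = of_real ((cmod t)\<^sup>2)" by (simp add: complex_mult_cnj cmod_def)
  finally show ?thesis unfolding vnormB_def by (simp add: real_sqrt_mult)
qed

text \<open>The eigenvector \<open>v\<close> turns the bound into an equality, so the supremum is a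
  maximum. Applied to an arbitrary eigenvector, the same bound limits its eigenvalue by
  \<open>cmod t\<close>, while \<open>t\<close> itself lies in the spectrum.\<close>

lemma mnormB_spectral_radius_attained:
  assumes B: "B \<in> carrier_mat n n" and E: "E \<in> carrier_mat n n"
    and pos: "\<And>x. x \<in> carrier_vec n \<Longrightarrow> x \<noteq> 0\<^sub>v n \<Longrightarrow> 0 < vnormB B x"
    and bound: "\<And>x. x \<in> carrier_vec n \<Longrightarrow> vnormB B (E *\<^sub>v x) \<le> cmod t * vnormB B x"
    and v: "v \<in> carrier_vec n" "v \<noteq> 0\<^sub>v n" "E *\<^sub>v v = t \<cdot>\<^sub>v v"
  shows "mnormB B E = cmod t" "spectral_radius E = cmod t"
proof -
  \<comment> \<open>The spectral radius is known to be an attained maximum only in positive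
    dimension.\<close>
  have n: "0 < n" using v(1,2) by (cases n) auto
  have "vnormB B (E *\<^sub>v v) / vnormB B v = cmod t"
    using pos[OF v(1,2)] unfolding v(3) vnormB_smult[OF B v(1)] by simp
  hence "cmod t \<in> (\<lambda>x. vnormB B (E *\<^sub>v x) / vnormB B x) ` {x \<in> carrier_vec n. x \<noteq> 0\<^sub>v n}"
    using v(1,2) by (intro image_eqI[of _ _ v]) auto
  moreover have "vnormB B (E *\<^sub>v x) / vnormB B x \<le> cmod t"
    if "x \<in> carrier_vec n" "x \<noteq> 0\<^sub>v n" for x
    using bound[OF that(1)] pos[OF that] by (simp add: pos_divide_le_eq)
  ultimately show "mnormB B E = cmod t"
    using E unfolding mnormB_def by (intro cSup_eq_maximum) auto
  have le: "cmod \<mu> \<le> cmod t" if \<mu>: "\<mu> \<in> spectrum E" for \<mu>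
  proof -
    obtain w where w: "w \<in> carrier_vec n" "w \<noteq> 0\<^sub>v n" "E *\<^sub>v w = \<mu> \<cdot>\<^sub>v w"
      using \<mu> E by (auto simp: spectrum_def eigenvalue_def eigenvector_def)
    have "cmod \<mu> * vnormB B w \<le> cmod t * vnormB B w"
      using bound[OF w(1)] unfolding w(3) vnormB_smult[OF B w(1)] .
    thus ?thesis using pos[OF w(1,2)] by simp
  qed
  have "t \<in> spectrum E"
    using v E unfolding spectrum_def eigenvalue_def eigenvector_def by auto
  hence "cmod t \<le> spectral_radius E" using spectral_radius_mem_max(2)[OF E n] by blast
  moreover have "spectral_radius E \<le> cmod t"
    using spectral_radius_mem_max(1)[OF E n] le by auto
  ultimately show "spectral_radius E = cmod t" by simp
qed

lemma mat_diag_mult_vec: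
  fixes u :: "complex vec"
  assumes "u \<in> carrier_vec n"
  shows "mat_diag n f *\<^sub>v u = vec n (\<lambda>i. f i * u $ i)"
proof (rule eq_vecI)
  fix i assume "i < dim_vec (vec n (\<lambda>i. f i * u $ i))"
  hence i: "i < n" by simp
  have "(mat_diag n f *\<^sub>v u) $ i = (\<Sum>j<n. (if i = j then f j else 0) * u $ j)"
    using i assms by (simp add: mat_diag_def scalar_prod_def atLeast0LessThan)
  also have "\<dots> = (\<Sum>j<n. if i = j then f j * u $ j else 0)"
    by (intro sum.cong) simp_all
  finally have "(mat_diag n f *\<^sub>v u) $ i = (\<Sum>j<n. if i = j then f j * u $ j else 0)" .
  thus "(mat_diag n f *\<^sub>v u) $ i = vec n (\<lambda>i. f i * u $ i) $ i" using i by simp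
qed (simp add: mat_diag_def)

text \<open>Moving one factor across the inner product gives the matrix \<open>G' * F * G\<close>
  with \<open>G'\<close> the adjoint of \<open>G\<close>; commuting \<open>G'\<close> past
  \<open>F\<close> collects the squared moduli in one diagonal matrix.\<close>

lemma form_mat_diag:
  assumes F: "F \<in> carrier_mat n n" and u: "u \<in> carrier_vec n"
    and comm: "F * mat_diag n (\<lambda>i. cnj (g i)) = mat_diag n (\<lambda>i. cnj (g i)) * F"
  shows "(F *\<^sub>v (mat_diag n g *\<^sub>v u)) \<bullet>c (mat_diag n g *\<^sub>v u) =
    (F *\<^sub>v (mat_diag n (\<lambda>i. of_real ((cmod (g i))\<^sup>2)) *\<^sub>v u)) \<bullet>c u"
proof -
  define G where "G = mat_diag n g"
  define G' where "G' = mat_diag n (\<lambda>i. cnj (g i))"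
  have c: "G \<in> carrier_mat n n" "G' \<in> carrier_mat n n" unfolding G_def G'_def by simp_all
  have GG: "G' * G = mat_diag n (\<lambda>i. of_real ((cmod (g i))\<^sup>2))"
    unfolding G_def G'_def mat_diag_diag
    by (rule arg_cong[where f = "mat_diag n"]) (rule ext, unfold complex_norm_square, rule mult.commute)
  have Gu: "G *\<^sub>v u \<in> carrier_vec n" using c u by simp
  have "(F *\<^sub>v (G *\<^sub>v u)) \<bullet>c (mat_adjoint G' *\<^sub>v u) = (G' *\<^sub>v (F *\<^sub>v (G *\<^sub>v u))) \<bullet>c u"
    by (rule scalar_prod_mat_adjoint[OF c(2) _ u, symmetric]) (use F Gu in simp)
  also have "mat_adjoint G' = G" unfolding G'_def G_def by simp
  also have "G' *\<^sub>v (F *\<^sub>v (G *\<^sub>v u)) = (G' * F) *\<^sub>v (G *\<^sub>v u)"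
    by (rule assoc_mult_mat_vec[OF c(2) F Gu, symmetric])
  also have "G' * F = F * G'" using comm unfolding G'_def by simp
  also have "(F * G') *\<^sub>v (G *\<^sub>v u) = F *\<^sub>v (G' *\<^sub>v (G *\<^sub>v u))"
    by (rule assoc_mult_mat_vec[OF F c(2) Gu])
  also have "G' *\<^sub>v (G *\<^sub>v u) = (G' * G) *\<^sub>v u"
    by (rule assoc_mult_mat_vec[OF c(2) c(1) u, symmetric])
  finally show ?thesis unfolding GG G_def[symmetric] .
qed

text \<open>With \<open>N = diag (sqrt (c\<^sup>2 - |f i|\<^sup>2))\<close>, which also commutes with \<open>F\<close>, the forms of
  \<open>diag f u\<close> and of \<open>N u\<close> add up to \<open>c\<^sup>2\<close> times the form of \<open>u\<close>.\<close>

lemma form_mat_diag_le: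
  assumes F: "F \<in> carrier_mat n n" "F * mat_diag n l = mat_diag n l * F"
    and psd: "\<And>u. u \<in> carrier_vec n \<Longrightarrow> 0 \<le> Re ((F *\<^sub>v u) \<bullet>c u)"
    and fibres: "\<And>i j. i < n \<Longrightarrow> j < n \<Longrightarrow> l i = l j \<Longrightarrow> f i = f j"
    and c: "\<And>i. i < n \<Longrightarrow> cmod (f i) \<le> c"
    and u: "u \<in> carrier_vec n"
  shows "Re ((F *\<^sub>v (mat_diag n f *\<^sub>v u)) \<bullet>c (mat_diag n f *\<^sub>v u)) \<le> c\<^sup>2 * Re ((F *\<^sub>v u) \<bullet>c u)"
proof -
  define d where "d i = complex_of_real (sqrt (c\<^sup>2 - (cmod (f i))\<^sup>2))" for i
  have re: "Re (complex_of_real r * z) = r * Re z" for r z by simp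
  let ?sq = "\<lambda>g. mat_diag n (\<lambda>i. complex_of_real ((cmod (g i))\<^sup>2)) *\<^sub>v u"
  \<comment> \<open>The bound on \<open>f\<close> makes the radicand in \<open>d\<close>
    nonnegative, so squaring the root recovers it.\<close>
  have d2: "(cmod (f i))\<^sup>2 + (cmod (d i))\<^sup>2 = c\<^sup>2" if "i < n" for i
    using power_mono[OF c[OF that] norm_ge_zero, of 2] unfolding d_def by simp
  have f: "(F *\<^sub>v (mat_diag n f *\<^sub>v u)) \<bullet>c (mat_diag n f *\<^sub>v u) = (F *\<^sub>v ?sq f) \<bullet>c u"
    by (rule form_mat_diag[OF F(1) u commutes_mat_diag_fun[OF F]]) (metis fibres)
  have d: "(F *\<^sub>v (mat_diag n d *\<^sub>v u)) \<bullet>c (mat_diag n d *\<^sub>v u) = (F *\<^sub>v ?sq d) \<bullet>c u"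
    by (rule form_mat_diag[OF F(1) u commutes_mat_diag_fun[OF F]]) (simp add: d_def, metis fibres)
  have cv: "?sq f \<in> carrier_vec n" "?sq d \<in> carrier_vec n"
    using mult_mat_vec_carrier[OF mat_diag_dim u] by blast+
  have "?sq f + ?sq d = of_real (c\<^sup>2) \<cdot>\<^sub>v u"
    unfolding mat_diag_mult_vec[OF u] using u
    by (intro eq_vecI)
      (simp_all add: d2 del: of_real_add of_real_power flip: distrib_right of_real_add)
  moreover have "(F *\<^sub>v ?sq f) \<bullet>c u + (F *\<^sub>v ?sq d) \<bullet>c u = (F *\<^sub>v (?sq f + ?sq d)) \<bullet>c u"
    using cv F(1) u by (simp add: mult_add_distrib_mat_vec[OF F(1)] add_scalar_prod_distrib[of _ n])
  ultimately have "(F *\<^sub>v ?sq f) \<bullet>c u + (F *\<^sub>v ?sq d) \<bullet>c u = of_real (c\<^sup>2) * ((F *\<^sub>v u) \<bullet>c u)"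
    using F(1) u by (simp add: mult_mat_vec[OF F(1) u])
  hence "Re ((F *\<^sub>v ?sq f) \<bullet>c u) + Re ((F *\<^sub>v ?sq d) \<bullet>c u) = c\<^sup>2 * Re ((F *\<^sub>v u) \<bullet>c u)"
    using re by (metis plus_complex.simps(1))
  moreover have "0 \<le> Re ((F *\<^sub>v ?sq d) \<bullet>c u)"
    using psd[OF mult_mat_vec_carrier[OF mat_diag_dim u]] unfolding d[symmetric] .
  ultimately show ?thesis unfolding f by simp
qed

section \<open>The coarse projection\<close>

definition lead_embed :: "nat \<Rightarrow> nat \<Rightarrow> complex mat" where
  "lead_embed n k = mat n k (\<lambda>(i, j). if i = j then 1 else 0)"

definition lead_proj :: "nat \<Rightarrow> nat \<Rightarrow> complex mat" where
  "lead_proj n k = mat_diag n (\<lambda>i. if i < k then 1 else 0)"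

lemma lead_embed_dim [simp]:
  "dim_row (lead_embed n k) = n" "dim_col (lead_embed n k) = k"
  unfolding lead_embed_def by simp_all

lemma lead_proj_dim [simp]:
  "dim_row (lead_proj n k) = n" "dim_col (lead_proj n k) = n"
  unfolding lead_proj_def mat_diag_def by simp_all

lemma lead_embed_adjoint_mult: "lead_embed n k * mat_adjoint (lead_embed n k) = lead_proj n k"
proof (rule eq_matI)
  fix i j assume "i < dim_row (lead_proj n k)" "j < dim_col (lead_proj n k)"
  hence ij: "i < n" "j < n" by simp_all
  have "(lead_embed n k * mat_adjoint (lead_embed n k)) $$ (i, j) =
      (\<Sum>m<k. (if i = m then 1 else 0) * cnj (if j = m then 1 else 0))"
    using ij by (simp add: scalar_prod_def atLeast0LessThan lead_embed_def)
  also have "\<dots> = (\<Sum>m<k. if i = m then (if j = m then 1 else 0) else 0)"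
    by (intro sum.cong) simp_all
  also have "\<dots> = lead_proj n k $$ (i, j)"
    using ij by (simp add: lead_proj_def mat_diag_def)
  finally show "(lead_embed n k * mat_adjoint (lead_embed n k)) $$ (i, j) = lead_proj n k $$ (i, j)" .
qed simp_all

lemma adjoint_lead_embed_lead_proj:
  "mat_adjoint (lead_embed n k) * lead_proj n k = mat_adjoint (lead_embed n k)"
  unfolding lead_proj_def
  by (subst mat_diag_mult_right[of _ k n]) (auto intro!: eq_matI carrier_matI simp: lead_embed_def)

text \<open>Selecting columns becomes a matrix product, so that the range conditions can be handled
  by algebra alone.\<close>

lemma first_cols_eq:
  assumes "V \<in> carrier_mat n n" "k \<le> n"
  shows "first_cols k V = V * lead_embed n k"
proof (rule eq_matI)
  fix i j assume "i < dim_row (V * lead_embed n k)" "j < dim_col (V * lead_embed n k)"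
  hence ij: "i < n" "j < k" using assms by auto
  have "(V * lead_embed n k) $$ (i, j) = (\<Sum>m<n. V $$ (i, m) * (if m = j then 1 else 0))"
    using ij assms by (simp add: scalar_prod_def atLeast0LessThan lead_embed_def)
  also have "\<dots> = (\<Sum>m<n. if m = j then V $$ (i, m) else 0)"
    by (intro sum.cong) simp_all
  also have "\<dots> = V $$ (i, j)" using ij assms by simp
  also have "\<dots> = first_cols k V $$ (i, j)"
    using ij assms by (simp add: first_cols_def mat_of_cols_index)
  finally show "first_cols k V $$ (i, j) = (V * lead_embed n k) $$ (i, j)" ..
qed (use assms in \<open>simp_all add: first_cols_def\<close>)

text \<open>Every column of \<open>P\<close> has a preimage under \<open>Q\<close>; chosen preimages
  are the columns of \<open>X\<close>.\<close>

lemma factor_through_col_range: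
  assumes P: "P \<in> carrier_mat n k" and Q: "Q \<in> carrier_mat n m"
    and sub: "col_range P \<subseteq> col_range Q"
  obtains X where "X \<in> carrier_mat m k" "P = Q * X"
proof -
  have rP: "col_range P = {y \<in> carrier_vec n. \<exists>x \<in> carrier_vec k. P *\<^sub>v x = y}"
    and rQ: "col_range Q = {y \<in> carrier_vec n. \<exists>x \<in> carrier_vec m. Q *\<^sub>v x = y}"
    using vec_space.col_space_eq[OF P] vec_space.col_space_eq[OF Q] P Q by auto
  have "\<exists>x \<in> carrier_vec m. Q *\<^sub>v x = col P j" if j: "j < k" for j
  proof -
    have "P *\<^sub>v unit_vec k j = P *\<^sub>v col (1\<^sub>m k) j" using j by simp
    also have "\<dots> = col P j" using col_mult2[OF P one_carrier_mat j] P by simp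
    finally have "P *\<^sub>v unit_vec k j = col P j" .
    hence "col P j \<in> col_range P" using P unfolding rP
      by (auto intro!: bexI[of _ "unit_vec k j"])
    thus ?thesis using sub unfolding rQ by auto
  qed
  then obtain x where x: "\<And>j. j < k \<Longrightarrow> x j \<in> carrier_vec m" "\<And>j. j < k \<Longrightarrow> Q *\<^sub>v x j = col P j"
    by metis
  define X where "X = mat_of_cols m (map x [0..<k])"
  have X: "X \<in> carrier_mat m k" unfolding X_def by (intro carrier_matI) simp_all
  have "P = Q * X"
  proof (rule mat_col_eqI)
    fix j assume "j < dim_col (Q * X)"
    hence j: "j < k" using X by simp
    have "col (Q * X) j = Q *\<^sub>v col X j" by (rule col_mult2[OF Q X j])
    also have "col X j = x j" unfolding X_def using j x(1) by simp
    finally show "col P j = col (Q * X) j" using x(2)[OF j] by simp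
  qed (use P Q X in auto)
  with X show thesis by (rule that)
qed

text \<open>Writing \<open>P = V J X\<close>, \<open>R = U J Y\<close> with \<open>J\<close> the leading columns of the identity,
  the coarse matrix is \<open>Y\<^sup>H h X\<close> with \<open>h = J\<^sup>H H J\<close>, so that \<open>X\<close> and \<open>Y\<close> cancel in the projection.\<close>

lemma coarse_proj_eq:
  assumes A: "A \<in> carrier_mat n n"
    and V: "V \<in> carrier_mat n n" and U: "U \<in> carrier_mat n n" and W: "W \<in> carrier_mat n n"
    and VW: "V * W = 1\<^sub>m n"
    and k: "k \<le> n"
    and comm: "mat_adjoint U * A * V * lead_proj n k = lead_proj n k * (mat_adjoint U * A * V)"
    and P: "P \<in> carrier_mat n k" "col_range P = col_range (first_cols k V)"
    and R: "R \<in> carrier_mat n k" "col_range R = col_range (first_cols k U)"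
    and coarse: "invertible_mat (coarse_mat A P R)"
  shows "coarse_proj A P R = V * lead_proj n k * W"
proof -
  define J where "J = lead_embed n k"
  define K where "K = lead_proj n k"
  define H where "H = mat_adjoint U * A * V"
  define h where "h = mat_adjoint J * H * J"
  have J: "J \<in> carrier_mat n k" unfolding J_def by (intro carrier_matI) simp_all
  obtain X where X: "X \<in> carrier_mat k k" "P = V * J * X"
    using factor_through_col_range[OF P(1) mult_carrier_mat[OF V J]] P(2)
    unfolding first_cols_eq[OF V k] J_def by blast
  obtain Y where Y: "Y \<in> carrier_mat k k" "R = U * J * Y"
    using factor_through_col_range[OF R(1) mult_carrier_mat[OF U J]] R(2)
    unfolding first_cols_eq[OF U k] J_def by blast
  have [simp]: "dim_row A = n" "dim_col A = n" "dim_row V = n" "dim_col V = n"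
    "dim_row U = n" "dim_col U = n" "dim_row W = n" "dim_col W = n"
    "dim_row J = n" "dim_col J = k" "dim_row K = n" "dim_col K = n"
    "dim_row H = n" "dim_col H = n" "dim_row h = k" "dim_col h = k"
    "dim_row X = k" "dim_col X = k" "dim_row Y = k" "dim_col Y = k"
    using A V U W J X(1) Y(1) by (auto simp: K_def H_def h_def)
  have C: "coarse_mat A P R = mat_adjoint Y * (h * X)"
    unfolding coarse_mat_def X(2) Y(2) h_def H_def
    by (simp add: mat_adjoint_mult assoc_mult_mat_dim)
  define Z where "Z = minv (coarse_mat A P R)"
  have "coarse_mat A P R \<in> carrier_mat k k" unfolding C by (intro carrier_matI) simp_all
  note Z = minv_inverse[OF this coarse, folded Z_def]
  have [simp]: "dim_row Z = k" "dim_col Z = k" using Z(1) by auto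
  \<comment> \<open>Invertibility of the coarse matrix exhibits a left inverse of the square matrix
    \<open>X\<close>, which is then also a right inverse; no rank argument for \<open>P\<close> is
    made.\<close>
  have "(Z * (mat_adjoint Y * h)) * X = 1\<^sub>m k"
    using Z(3) unfolding C by (simp add: assoc_mult_mat_dim)
  hence inv: "X * (Z * (mat_adjoint Y * h)) = 1\<^sub>m k"
    by (rule mat_mult_left_right_inverse[rotated 2]) (use X in \<open>auto intro!: carrier_matI\<close>)
  have UA: "mat_adjoint U * A = H * W"
    unfolding H_def using VW by (simp add: assoc_mult_mat_dim)
  \<comment> \<open>Commutation with \<open>K\<close> enters here: the leading rows of
    \<open>H\<close> vanish outside the leading columns, so \<open>H\<close> can be replaced by its
    corner \<open>h\<close>.\<close>
  have "mat_adjoint J * H = mat_adjoint J * K * H"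
    unfolding J_def K_def adjoint_lead_embed_lead_proj ..
  also have "\<dots> = mat_adjoint J * (H * K)"
    using comm unfolding H_def[symmetric] K_def[symmetric] by (simp add: assoc_mult_mat_dim)
  also have "\<dots> = h * mat_adjoint J"
    unfolding h_def K_def lead_embed_adjoint_mult[symmetric] J_def[symmetric]
    by (simp add: assoc_mult_mat_dim)
  finally have JH: "mat_adjoint J * H = h * mat_adjoint J" .
  have "coarse_proj A P R = V * J * X * Z * mat_adjoint Y * mat_adjoint J * (mat_adjoint U * A)"
    unfolding coarse_proj_def Z_def[symmetric] unfolding X(2) Y(2)
    by (simp add: mat_adjoint_mult assoc_mult_mat_dim)
  also have "\<dots> = V * J * X * Z * mat_adjoint Y * (mat_adjoint J * H) * W"
    unfolding UA by (simp add: assoc_mult_mat_dim)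
  also have "\<dots> = V * J * (X * (Z * (mat_adjoint Y * h))) * mat_adjoint J * W"
    unfolding JH by (simp add: assoc_mult_mat_dim)
  also have "\<dots> = V * (J * mat_adjoint J) * W"
    unfolding inv by (simp add: assoc_mult_mat_dim)
  finally show ?thesis unfolding J_def lead_embed_adjoint_mult .
qed

section \<open>Matrices diagonal in a given basis\<close>

text \<open>With \<open>W\<close> inverse to \<open>V\<close>, the map from \<open>f\<close> to this
  matrix respects sums, products and the identity, so operator identities become pointwise
  identities of functions on indices.\<close>

definition diag_sim :: "complex mat \<Rightarrow> complex mat \<Rightarrow> (nat \<Rightarrow> complex) \<Rightarrow> complex mat" where
  "diag_sim V W f = V * mat_diag (dim_col V) f * W"

lemma diag_sim_carrier [simp]:
  "V \<in> carrier_mat n n \<Longrightarrow> W \<in> carrier_mat n n \<Longrightarrow> diag_sim V W f \<in> carrier_mat n n"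
  unfolding diag_sim_def by (intro carrier_matI) simp_all

lemma diag_sim_mult:
  assumes "V \<in> carrier_mat n n" "W \<in> carrier_mat n n" "W * V = 1\<^sub>m n"
  shows "diag_sim V W f * diag_sim V W g = diag_sim V W (\<lambda>i. f i * g i)"
proof -
  have [simp]: "dim_row V = n" "dim_col V = n" "dim_row W = n" "dim_col W = n"
    using assms by auto
  have "diag_sim V W f * diag_sim V W g = V * (mat_diag n f * mat_diag n g) * W"
    unfolding diag_sim_def
    by (simp add: assoc_mult_mat_dim mult_mat_cancel_left[OF assms(3)] del: mat_diag_diag)
  thus ?thesis unfolding diag_sim_def by simp
qed

lemma diag_sim_one:
  assumes "V \<in> carrier_mat n n" "W \<in> carrier_mat n n" "V * W = 1\<^sub>m n"
  shows "diag_sim V W (\<lambda>i. 1) = 1\<^sub>m n"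
  using assms unfolding diag_sim_def by simp

lemma diag_sim_one_minus:
  assumes V: "V \<in> carrier_mat n n" and W: "W \<in> carrier_mat n n" and VW: "V * W = 1\<^sub>m n"
  shows "1\<^sub>m n - diag_sim V W f = diag_sim V W (\<lambda>i. 1 - f i)"
proof -
  have "mat_diag n (\<lambda>i. 1 - f i) = 1\<^sub>m n - mat_diag n f"
    by (rule eq_matI) (auto simp: mat_diag_def)
  hence "diag_sim V W (\<lambda>i. 1 - f i) = V * (1\<^sub>m n - mat_diag n f) * W"
    using V unfolding diag_sim_def by simp
  also have "V * (1\<^sub>m n - mat_diag n f) = V * 1\<^sub>m n - V * mat_diag n f"
    by (rule mult_minus_distrib_mat[OF V one_carrier_mat mat_diag_dim])
  also have "\<dots> * W = V * 1\<^sub>m n * W - V * mat_diag n f * W"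
    by (rule minus_mult_distrib_mat[OF _ _ W, of _ n]) (use V in \<open>auto intro: mult_carrier_mat[OF V]\<close>)
  finally show ?thesis using V W VW unfolding diag_sim_def by simp
qed

lemma diag_sim_pow:
  assumes V: "V \<in> carrier_mat n n" and W: "W \<in> carrier_mat n n"
    and VW: "V * W = 1\<^sub>m n" and WV: "W * V = 1\<^sub>m n"
  shows "diag_sim V W f ^\<^sub>m k = diag_sim V W (\<lambda>i. f i ^ k)"
proof (induction k)
  case 0
  show ?case using diag_sim_one[OF V W VW] diag_sim_carrier[OF V W, of f] by simp
next
  case (Suc k)
  thus ?case using diag_sim_mult[OF V W WV] by (simp add: mult.commute)
qed

text \<open>The eigenvector is column \<open>i\<close> of \<open>V\<close>, written as an image of a
  unit vector so that \<open>W * V\<close> cancels; the same cancellation shows that it is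
  nonzero.\<close>

lemma diag_sim_eigenvector:
  assumes V: "V \<in> carrier_mat n n" and W: "W \<in> carrier_mat n n" and WV: "W * V = 1\<^sub>m n"
    and i: "i < n"
  shows "diag_sim V W f *\<^sub>v (V *\<^sub>v unit_vec n i) = f i \<cdot>\<^sub>v (V *\<^sub>v unit_vec n i)"
    "V *\<^sub>v unit_vec n i \<noteq> 0\<^sub>v n"
proof -
  have e: "unit_vec n i \<in> carrier_vec n" by simp
  have We: "W *\<^sub>v (V *\<^sub>v unit_vec n i) = unit_vec n i"
    unfolding assoc_mult_mat_vec[OF W V e, symmetric] WV by simp
  have "mat_diag n f *\<^sub>v unit_vec n i = f i \<cdot>\<^sub>v unit_vec n i"
    unfolding mat_diag_mult_vec[OF e] using i by (intro eq_vecI) auto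
  moreover have "diag_sim V W f *\<^sub>v (V *\<^sub>v unit_vec n i)
      = V *\<^sub>v (mat_diag n f *\<^sub>v (W *\<^sub>v (V *\<^sub>v unit_vec n i)))"
    using V W e mult_mat_vec_carrier[OF V e] unfolding diag_sim_def
    by (simp add: assoc_mult_mat_vec[of _ n n _ n] mult_carrier_mat[OF V mat_diag_dim]
        mult_mat_vec_carrier[OF W])
  ultimately show "diag_sim V W f *\<^sub>v (V *\<^sub>v unit_vec n i) = f i \<cdot>\<^sub>v (V *\<^sub>v unit_vec n i)"
    unfolding We by (simp add: mult_mat_vec[OF V e])
  show "V *\<^sub>v unit_vec n i \<noteq> 0\<^sub>v n"
  proof
    assume "V *\<^sub>v unit_vec n i = 0\<^sub>v n"
    moreover have "W *\<^sub>v 0\<^sub>v n = 0\<^sub>v n" using W by (intro eq_vecI) auto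
    ultimately have "unit_vec n i = (0\<^sub>v n :: complex vec)" using We by simp
    thus False using i by (metis index_unit_vec(1) index_zero_vec(1) zero_neq_one)
  qed
qed

theorem theorem4p8:
  fixes n nc nf \<nu>1 \<nu>2 :: nat
    and A M Vr Vl \<Lambda> \<Lambda>c \<Lambda>f D Dc Df B P R :: "complex mat"
    and lam :: "nat \<Rightarrow> complex"
    and bc bf :: "(nat \<times> complex) list"
  assumes dims: "nc < n" "nf < n" "nc + nf = n"
    and A: "A \<in> carrier_mat n n" "invertible_mat A"
    and M: "M \<in> carrier_mat n n" "invertible_mat M"
    and normal: "normalB B (minv M * A)"
    and Vr: "Vr \<in> carrier_mat n n" "invertible_mat Vr"
    and Vl: "Vl \<in> carrier_mat n n" "invertible_mat Vl"
    and right_eig: "A * Vr = M * Vr * \<Lambda>"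
    and left_eig: "mat_adjoint Vl * A = \<Lambda> * mat_adjoint Vl * M"
    and \<Lambda>_diag: "\<Lambda> = mat_diag n (\<lambda>i. lam (i + 1))"
    and \<Lambda>_split: "\<Lambda>c \<in> carrier_mat nc nc" "\<Lambda>f \<in> carrier_mat nf nf" "\<Lambda> = block_diag2 \<Lambda>c \<Lambda>f"
    and ordered: "\<And>i j. 1 \<le> i \<Longrightarrow> i \<le> j \<Longrightarrow> j \<le> n \<Longrightarrow> cmod (1 - lam j) \<le> cmod (1 - lam i)"
    and blocks: "equal_eigenvalue_blocks \<Lambda>c \<Lambda>f bc bf"
    and D: "hermitian_pd n D" "D = block_diag2 Dc Df"
    and Dc: "hermitian_pd nc Dc" "block_diagonal (map fst bc) Dc"
    and Df: "hermitian_pd nf Df" "block_diagonal (map fst bf) Df"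
    and B: "B = minv (mat_adjoint Vr) * minv D * minv Vr"
    and P: "P \<in> carrier_mat n nc" "col_range P = col_range (first_cols nc Vr)"
    and R: "R \<in> carrier_mat n nc" "col_range R = col_range (first_cols nc Vl)"
    and coarse: "invertible_mat (coarse_mat A P R)"
  shows "orthogonalB B (coarse_proj A P R)
    \<and> spectral_radius (two_grid A M \<nu>1 \<nu>2 P R) = mnormB B (two_grid A M \<nu>1 \<nu>2 P R)
    \<and> mnormB B (two_grid A M \<nu>1 \<nu>2 P R) = cmod (1 - lam (nc + 1)) ^ (\<nu>1 + \<nu>2)"
proof -

  \<comment> \<open>Inverses and eigenvalue data\<close>
  define W where "W = minv Vr"
  define F where "F = minv D"
  \<comment> \<open>Shift from eigenvalues numbered from 1 to matrix indices from 0: the first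
    trailing eigenvalue \<open>lam (nc + 1)\<close> becomes \<open>L nc\<close>.\<close>
  define L where "L i = lam (i + 1)" for i
  define K where "K i = (if i < nc then 1 else 0 :: complex)" for i
  have \<Lambda>: "\<Lambda> = mat_diag n L" unfolding \<Lambda>_diag L_def ..
  note W = minv_inverse[OF Vr, folded W_def]
  have Dn: "D \<in> carrier_mat n n" using D(1) unfolding hermitian_pd_def by blast
  note F = minv_inverse[OF Dn hermitian_pd_invertible[OF D(1)], folded F_def]
  note Mi = minv_inverse[OF M]
  have [simp]: "dim_row A = n" "dim_col A = n" "dim_row M = n" "dim_col M = n"
    "dim_row Vr = n" "dim_col Vr = n" "dim_row Vl = n" "dim_col Vl = n"
    "dim_row W = n" "dim_col W = n" "dim_row D = n" "dim_col D = n"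
    "dim_row F = n" "dim_col F = n" "dim_row (minv M) = n" "dim_col (minv M) = n"
    using A(1) M(1) Vr(1) Vl(1) W(1) Dn F(1) Mi(1) by auto
  have adj: "mat_adjoint Vr * mat_adjoint W = 1\<^sub>m n"
    using arg_cong[OF W(3), of mat_adjoint] by (simp add: mat_adjoint_mult)
  have B': "B = mat_adjoint W * F * W"
    unfolding B F_def W_def[symmetric]
    using minv_unique[OF _ _ adj] Vr(1) W(1) by simp
  have Bn: "B \<in> carrier_mat n n" unfolding B' by (intro carrier_matI) simp_all

  \<comment> \<open>Commutation with the eigenvalue matrix\<close>
  have "D * \<Lambda> = \<Lambda> * D"
  proof -
    obtain Xs Ys where X: "Dc = diag_block_mat Xs" "Df = diag_block_mat Ys"
      "list_all2 (\<lambda>k Y. Y \<in> carrier_mat k k) (map fst bc) Xs"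
      "list_all2 (\<lambda>k Y. Y \<in> carrier_mat k k) (map fst bf) Ys"
      using Dc(2) Df(2) unfolding block_diagonal_def by blast
    \<comment> \<open>Joining the leading and trailing block lists lets \<open>D\<close> and
      \<open>\<Lambda>\<close> be compared block by block as whole matrices.\<close>
    have "list_all2 (\<lambda>k Y. Y \<in> carrier_mat k k) (map fst (bc @ bf)) (Xs @ Ys)"
      using list_all2_appendI[OF X(3,4)] by simp
    hence "list_all2 (\<lambda>(k, \<mu>) Y. Y \<in> carrier_mat k k) (bc @ bf) (Xs @ Ys)"
      unfolding list_all2_map1 by (simp add: case_prod_beta')
    moreover have "\<Lambda> = scalar_blocks (bc @ bf)"
      using blocks unfolding \<Lambda>_split(3) equal_eigenvalue_blocks_def scalar_blocks_def
      by (simp add: block_diag2_diag_block_mat)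
    ultimately show ?thesis
      using diag_block_mat_commutes_scalar_blocks
      unfolding D(2) X(1,2) block_diag2_diag_block_mat by metis
  qed
  hence DL: "D * mat_diag n L = mat_diag n L * D" unfolding \<Lambda> .
  have FL: "F * mat_diag n L = mat_diag n L * F"
    by (rule inverse_commutes[OF Dn F mat_diag_dim DL])

  \<comment> \<open>Reading the diagonal of \<open>\<Lambda>\<close> through its two blocks places
    \<open>L i\<close> among the eigenvalues of \<open>bc\<close> and \<open>L j\<close> among those
    of \<open>bf\<close>, and these sets are disjoint. Hence \<open>K\<close> is a function of the
    eigenvalue.\<close>
  have L_ne: "L i \<noteq> L j" if "i < nc" "nc \<le> j" "j < n" for i j
  proof -
    have "L i = \<Lambda> $$ (i, i)" "L j = \<Lambda> $$ (j, j)"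
      using that unfolding \<Lambda> mat_diag_def by simp_all
    moreover have "\<Lambda> $$ (i, i) = \<Lambda>c $$ (i, i)" "\<Lambda> $$ (j, j) = \<Lambda>f $$ (j - nc, j - nc)"
      unfolding \<Lambda>_split(3) block_diag2_four_block
      by (subst index_mat_four_block(1); use that \<Lambda>_split(1,2) dims in simp)+
    moreover have "\<Lambda>c $$ (i, i) \<in> snd ` set bc" "\<Lambda>f $$ (j - nc, j - nc) \<in> snd ` set bf"
      using scalar_blocks_diag_entry[of i bc] scalar_blocks_diag_entry[of "j - nc" bf]
        blocks that dims \<Lambda>_split(1,2) unfolding equal_eigenvalue_blocks_def by auto
    moreover have "snd ` set bc \<inter> snd ` set bf = {}"
      using blocks unfolding equal_eigenvalue_blocks_def by auto
    ultimately show ?thesis by (metis disjoint_iff)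
  qed
  have K_L: "K i = K j" if "i < n" "j < n" "L i = L j" for i j
  proof -
    have "i < nc \<longleftrightarrow> j < nc" using L_ne[of i j] L_ne[of j i] that
      by (cases "i < nc"; cases "j < nc") simp_all
    thus ?thesis unfolding K_def by simp
  qed

  \<comment> \<open>The matrix \<open>A\<close> between left and right eigenvectors\<close>
  define H where "H = mat_adjoint Vl * A * Vr"
  define G where "G = mat_adjoint Vl * M * Vr"
  have Hn: "H \<in> carrier_mat n n" unfolding H_def by (intro carrier_matI) simp_all
  have [simp]: "dim_row G = n" "dim_col G = n" unfolding G_def by simp_all
  have "H = mat_adjoint Vl * (A * Vr)" unfolding H_def by (simp add: assoc_mult_mat_dim)
  also have "\<dots> = G * mat_diag n L"
    unfolding right_eig \<Lambda> G_def by (simp add: assoc_mult_mat_dim)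
  finally have HG: "H = G * mat_diag n L" .
  have GH: "H = mat_diag n L * G"
    unfolding H_def left_eig unfolding \<Lambda> G_def by (simp add: assoc_mult_mat_dim)
  \<comment> \<open>The right eigenvalue equation gives \<open>H\<close> as \<open>G\<close> times
    \<open>\<Lambda>\<close>, the left one as \<open>\<Lambda>\<close> times \<open>G\<close>; using
    one for each factorization makes \<open>H\<close> commute with \<open>\<Lambda>\<close>.\<close>
  have "H * mat_diag n L = mat_diag n L * (G * mat_diag n L)"
    unfolding GH by (simp add: assoc_mult_mat_dim)
  hence HL: "H * mat_diag n L = mat_diag n L * H" unfolding HG[symmetric] .

  have K: "lead_proj n nc = mat_diag n K" unfolding lead_proj_def K_def ..
  have "H * lead_proj n nc = lead_proj n nc * H"
    unfolding K by (rule commutes_mat_diag_fun[OF Hn HL]) (rule K_L)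
  from coarse_proj_eq[OF A(1) Vr(1) Vl(1) W(1,2) _ this[unfolded H_def] P R coarse]
  have \<Pi>: "coarse_proj A P R = diag_sim Vr W K"
    using dims(1) unfolding K diag_sim_def by simp

  \<comment> \<open>Self-adjointness of the coarse projection\<close>
  have DK: "D * mat_diag n K = mat_diag n K * D"
    by (rule commutes_mat_diag_fun[OF Dn DL]) (rule K_L)
  have "B * (Vr * D * mat_adjoint Vr) = mat_adjoint W * mat_adjoint Vr"
    unfolding B'
    by (simp add: assoc_mult_mat_dim mult_mat_cancel_left[OF W(3)] mult_mat_cancel_left[OF F(3)])
  also have "\<dots> = 1\<^sub>m n" using arg_cong[OF W(2), of mat_adjoint] by (simp add: mat_adjoint_mult)
  finally have minv_B: "minv B = Vr * D * mat_adjoint Vr"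
    by (intro minv_unique[OF Bn]) (intro carrier_matI, simp_all)
  have cnj_K: "(\<lambda>i. cnj (K i)) = K" unfolding K_def by auto
  \<comment> \<open>In eigenvector coordinates the \<open>B\<close>-adjoint conjugates the adjoint
    of \<open>K\<close> by \<open>D\<close>; since \<open>K\<close> is real and commutes with
    \<open>D\<close>, it is unchanged.\<close>
  have "adjointB B (diag_sim Vr W K) = Vr * (D * mat_diag n K) * (F * W)"
    unfolding adjointB_def minv_B unfolding B' diag_sim_def
    by (simp add: mat_adjoint_mult assoc_mult_mat_dim mult_mat_cancel_left[OF adj] cnj_K)
  also have "\<dots> = diag_sim Vr W K"
    unfolding DK diag_sim_def
    by (simp add: assoc_mult_mat_dim mult_mat_cancel_left[OF F(2)])
  finally have orth: "orthogonalB B (coarse_proj A P R)" unfolding orthogonalB_def \<Pi> .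

  \<comment> \<open>The two-grid operator in the right eigenbasis\<close>
  define T where "T i = (1 - L i) ^ \<nu>2 * (1 - K i) * (1 - L i) ^ \<nu>1" for i
  have "A = A * (Vr * W)" using A(1) unfolding W(2) by simp
  also have "\<dots> = M * diag_sim Vr W L"
    using arg_cong[OF right_eig, of "\<lambda>X. X * W"] unfolding \<Lambda> diag_sim_def
    by (simp add: assoc_mult_mat_dim)
  finally have "minv M * A = minv M * (M * diag_sim Vr W L)" by simp
  also have "\<dots> = diag_sim Vr W L"
    by (rule mult_mat_cancel_left[OF Mi(3)]) (simp_all add: diag_sim_def)
  \<comment> \<open>All factors are now of the form \<open>diag_sim\<close>, so the powers,
    differences and products act on the diagonal entries.\<close>
  finally have E: "two_grid A M \<nu>1 \<nu>2 P R = diag_sim Vr W T"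
    unfolding two_grid_def Let_def \<Pi>
    by (simp add: T_def[abs_def] diag_sim_one_minus[OF Vr(1) W(1,2)] diag_sim_pow[OF Vr(1) W]
        diag_sim_mult[OF Vr(1) W(1,3)])

  \<comment> \<open>Norm and operator bound in eigenvector coordinates\<close>
  have norm: "vnormB B x = sqrt (Re ((F *\<^sub>v (W *\<^sub>v x)) \<bullet>c (W *\<^sub>v x)))"
    if x: "x \<in> carrier_vec n" for x
  proof -
    have Wx: "W *\<^sub>v x \<in> carrier_vec n" using W(1) x by simp
    have "B *\<^sub>v x = mat_adjoint W *\<^sub>v (F *\<^sub>v (W *\<^sub>v x))"
      unfolding B' using W(1) F(1) x Wx
      by (simp add: assoc_mult_mat_vec[of _ n n _ n] mult_carrier_mat[of _ n n])
    also have "\<dots> \<bullet>c x = (F *\<^sub>v (W *\<^sub>v x)) \<bullet>c (mat_adjoint (mat_adjoint W) *\<^sub>v x)"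
      by (rule scalar_prod_mat_adjoint[of _ n n]) (use W(1) F(1) x Wx in simp_all)
    finally show ?thesis unfolding vnormB_def by simp
  qed
  have pos: "0 < vnormB B x" if x: "x \<in> carrier_vec n" "x \<noteq> 0\<^sub>v n" for x
  proof -
    have "Vr *\<^sub>v (W *\<^sub>v x) = x"
      unfolding assoc_mult_mat_vec[OF Vr(1) W(1) x(1), symmetric] W(2) using x by simp
    moreover have "Vr *\<^sub>v 0\<^sub>v n = 0\<^sub>v n" using Vr(1) by (intro eq_vecI) auto
    ultimately have "W *\<^sub>v x \<noteq> 0\<^sub>v n" using x(2) by metis
    thus ?thesis unfolding norm[OF x(1)] F_def
      using hermitian_pd_minv_pos[OF D(1)] W(1) x(1) by simp
  qed
  have psd: "0 \<le> Re ((F *\<^sub>v u) \<bullet>c u)" if "u \<in> carrier_vec n" for u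
  proof (cases "u = 0\<^sub>v n")
    case True
    thus ?thesis using F(1) by simp
  next
    case False
    thus ?thesis using hermitian_pd_minv_pos[OF D(1) that] unfolding F_def by simp
  qed
  have T_nc: "T nc = (1 - lam (nc + 1)) ^ (\<nu>1 + \<nu>2)"
    unfolding T_def K_def L_def by (simp add: power_add)
  \<comment> \<open>Leading entries vanish because \<open>1 - K i\<close> is zero there; for
    trailing ones the ordering makes index \<open>nc\<close> dominant.\<close>
  have T_le: "cmod (T i) \<le> cmod (T nc)" if i: "i < n" for i
  proof (cases "i < nc")
    case True
    thus ?thesis unfolding T_def K_def by simp
  next
    case False
    hence "cmod (1 - L i) \<le> cmod (1 - L nc)"
      unfolding L_def using i by (intro ordered) auto
    hence "cmod (1 - L i) ^ (\<nu>1 + \<nu>2) \<le> cmod (1 - L nc) ^ (\<nu>1 + \<nu>2)"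
      by (rule power_mono) simp
    thus ?thesis using False unfolding T_def K_def
      by (simp add: norm_mult norm_power power_add mult.commute)
  qed
  have bound: "vnormB B (diag_sim Vr W T *\<^sub>v x) \<le> cmod (T nc) * vnormB B x"
    if x: "x \<in> carrier_vec n" for x
  proof -
    have Wx: "W *\<^sub>v x \<in> carrier_vec n" using W(1) x by simp
    have DWx: "mat_diag n T *\<^sub>v (W *\<^sub>v x) \<in> carrier_vec n"
      by (rule mult_mat_vec_carrier[OF mat_diag_dim Wx])
    have Ex: "diag_sim Vr W T *\<^sub>v x = Vr *\<^sub>v (mat_diag n T *\<^sub>v (W *\<^sub>v x))"
      using Vr(1) W(1) x Wx unfolding diag_sim_def
      by (simp add: assoc_mult_mat_vec[of _ n n _ n] mult_carrier_mat[OF Vr(1) mat_diag_dim])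
    have WEx: "W *\<^sub>v (diag_sim Vr W T *\<^sub>v x) = mat_diag n T *\<^sub>v (W *\<^sub>v x)"
      unfolding Ex assoc_mult_mat_vec[OF W(1) Vr(1) DWx, symmetric] W(3) using DWx by simp
    have "diag_sim Vr W T *\<^sub>v x \<in> carrier_vec n"
      unfolding Ex by (rule mult_mat_vec_carrier[OF Vr(1) DWx])
    from norm[OF this] have "vnormB B (diag_sim Vr W T *\<^sub>v x) =
        sqrt (Re ((F *\<^sub>v (mat_diag n T *\<^sub>v (W *\<^sub>v x))) \<bullet>c (mat_diag n T *\<^sub>v (W *\<^sub>v x))))"
      unfolding WEx .
    also have "\<dots> \<le> sqrt ((cmod (T nc))\<^sup>2 * Re ((F *\<^sub>v (W *\<^sub>v x)) \<bullet>c (W *\<^sub>v x)))"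
    proof (rule real_sqrt_le_mono, rule form_mat_diag_le[OF F(1) FL psd _ T_le Wx])
      \<comment> \<open>The entry \<open>T i\<close> depends on \<open>i\<close> only through
        \<open>L i\<close> and \<open>K i\<close>, and \<open>K\<close> is constant on equal
        eigenvalues.\<close>
      fix i j assume "i < n" "j < n" "L i = L j"
      thus "T i = T j" unfolding T_def using K_L[of i j] by simp
    qed
    also have "\<dots> = cmod (T nc) * vnormB B x"
      unfolding norm[OF x] by (simp add: real_sqrt_mult)
    finally show ?thesis .
  qed
  \<comment> \<open>The bound is attained at column \<open>nc\<close> of \<open>Vr\<close>, counted
    from 0, which exists since \<open>nc < n\<close>.\<close>
  have "Vr *\<^sub>v unit_vec n nc \<in> carrier_vec n"
    by (rule mult_mat_vec_carrier[OF Vr(1) unit_vec_carrier])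
  note mnormB_spectral_radius_attained[OF Bn diag_sim_carrier[OF Vr(1) W(1)] pos bound this
      diag_sim_eigenvector(2,1)[OF Vr(1) W(1,3) dims(1)]]
  thus ?thesis using orth unfolding E T_nc by (simp add: norm_power)
qed

end
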